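(* Let $\{f_n\}_{n\ge 1}$ and $\{a_n\}_{n\ge 1}$ be sequences of integers, let $F(x)=\sum_{n>0} f_n x^n$, let $R(x)=\sum_{n>0}\frac{a_n}{n}x^n$, and let $G(x)=\sum_{n>0} g_n x^n$ be the composition $G(x)=R(F(x))$, so that $g_n=\sum_{k=1}^{n}\frac{F^{\Delta}(n,k)\,a_k}{k}$, where $F^{\Delta}(n,k)$ is the composita of $F(x)$. Then the value $$\sum_{k=1}^{n-1}\frac{F^{\Delta}(n,k)\,a_k}{k}=\frac{n g_n-a_n f_1^n}{n}$$ is an integer for every prime $n$. The converse is not true: there exist sequences of integers $\{f_n\}_{n\ge 1}$, $\{a_n\}_{n\ge 1}$ and a composite $n$ for which the value $\sum_{k=1}^{n-1}\frac{F^{\Delta}(n,k)\,a_k}{k}$, where $F^{\Delta}(n,k)$ is the composita of $F(x)=\sum_{n>0} f_n x^n$, is an integer.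
   Context: All generating functions are formal power series (with rational coefficients). For $R(x)=\sum_{n\ge 0} r_n x^n$ and $F(x)=\sum_{n>0} f_n x^n$ (zero constant term), the composition is the well-defined formal power series $R(F(x))=\sum_{n\ge 0} r_n F(x)^n$. The composita of $F(x)=\sum_{n>0} f_n x^n$ is the function of two variables $$F^{\Delta}(n,k)=\sum f_{\lambda_1} f_{\lambda_2}\cdots f_{\lambda_k},$$ where the sum runs over all compositions of $n$ into exactly $k$ parts, i.e. all ordered $k$-tuples $(\lambda_1,\dots,\lambda_k)$ of positive integers with $\lambda_1+\cdots+\lambda_k=n$. Equivalently, $F(x)^k=\sum_{n\ge k}F^{\Delta}(n,k)x^n$. *)

theory Defs
  imports
    "HOL-Computational_Algebra.Formal_Power_Series"
    "HOL-Computational_Algebra.Primes"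
begin

(* The series c_1 x + c_2 x^2 + ...; a sequence indexed by n >= 1 is represented by a
   function on nat whose value at 0 is ignored. *)
definition series_from_1 :: "(nat \<Rightarrow> 'a::zero) \<Rightarrow> 'a fps" where
  "series_from_1 c = Abs_fps (\<lambda>n. if n = 0 then 0 else c n)"

definition compositions :: "nat \<Rightarrow> nat \<Rightarrow> nat list set" where
  "compositions n k = {ls. length ls = k \<and> (\<forall>l\<in>set ls. l > 0) \<and> sum_list ls = n}"

(* Hence the sum defining the composita is never the default value of an infinite sum. *)
lemma finite_compositions: "finite (compositions n k)"
proof (rule finite_subset)
  show "compositions n k \<subseteq> {ls. set ls \<subseteq> {..n} \<and> length ls = k}"
    unfolding compositions_def using member_le_sum_list by fastforce
  show "finite {ls. set ls \<subseteq> {..n} \<and> length ls = k}"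
    by (rule finite_lists_length_eq) simp
qed

definition composita :: "'a::comm_semiring_1 fps \<Rightarrow> nat \<Rightarrow> nat \<Rightarrow> 'a" where
  "composita F n k = (\<Sum>ls\<in>compositions n k. \<Prod>l\<leftarrow>ls. fps_nth F l)"

end

theory Submission
  imports Defs
begin

text \<open>
  The theorem rests on one divisibility: for an integer series \<open>F\<close>, differentiating \<open>F\<^sup>k\<close> gives
  \<open>(F\<^sup>k)' = k F\<^sup>k\<^sup>-\<^sup>1 F'\<close>, and comparing coefficients of \<open>x\<^sup>n\<^sup>-\<^sup>1\<close> shows that \<open>k\<close> divides
  \<open>n\<close> times the coefficient of \<open>x\<^sup>n\<close> in \<open>F\<^sup>k\<close> (\<open>dvd_mult_nth_power\<close>). When \<open>n\<close> is prime
  and \<open>0 < k < n\<close>, the factor \<open>n\<close> can be cancelled, so every single term of the sum is an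
  integer. The remaining identities read off coefficients of \<open>R(F(x))\<close>, where the composita
  occurs as the coefficient of \<open>x\<^sup>n\<close> in \<open>F\<^sup>k\<close> (\<open>composita_eq_nth_power\<close>), and the term
  \<open>k = n\<close> contains \<open>f\<^sub>1\<^sup>n\<close>, the lowest possibly nonzero coefficient of \<open>F\<^sup>n\<close>.

  The converse fails because the denominators can also cancel for another reason: if \<open>k\<close>
  divides \<open>a\<^sub>k\<close> for all \<open>k\<close>, every term is an integer for every \<open>n\<close>, composite or not.
\<close>

text \<open>
  Expanding the product \<open>F\<^sup>k\<close> gives the same sum over all lists of \<open>k\<close> naturals with sum \<open>n\<close>;
  the lists containing a zero contribute nothing because the constant term vanishes.
\<close>

lemma composita_eq_nth_power:
  fixes F :: "'a::comm_ring_1 fps"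
  assumes "fps_nth F 0 = 0"
  shows "composita F n k = fps_nth (F ^ k) n"
proof (cases k)
  case 0
  have "compositions n 0 = (if n = 0 then {[]} else {})"
    by (auto simp: compositions_def)
  then show ?thesis
    by (simp add: 0 composita_def)
next
  case (Suc m)
  have "composita F n k = (\<Sum>ls\<in>natpermute n k. \<Prod>l\<leftarrow>ls. fps_nth F l)"
    unfolding composita_def
  proof (rule sum.mono_neutral_left)
    show "finite (natpermute n k)"
      by (rule natpermute_finite)
    show "compositions n k \<subseteq> natpermute n k"
      by (auto simp: compositions_def natpermute_def)
    show "\<forall>ls\<in>natpermute n k - compositions n k. (\<Prod>l\<leftarrow>ls. fps_nth F l) = 0"
    proof
      fix ls
      assume "ls \<in> natpermute n k - compositions n k"
      then have "0 \<in> set ls"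
        by (auto simp: compositions_def natpermute_def)
      then show "(\<Prod>l\<leftarrow>ls. fps_nth F l) = 0"
        using assms by (induction ls) auto
    qed
  qed
  also have "\<dots> = (\<Sum>ls\<in>natpermute n k. \<Prod>j = 0..m. fps_nth F (ls ! j))"
    by (rule sum.cong)
       (auto simp: natpermute_def Suc prod.list_conv_set_nth atLeastLessThanSuc_atLeastAtMost
             simp del: prod.op_ivl_Suc intro!: prod.cong)
  also have "\<dots> = fps_nth (F ^ k) n"
    unfolding Suc fps_power_nth_Suc by simp
  finally show ?thesis .
qed

lemma composita_of_int:
  "composita (series_from_1 (\<lambda>n. of_int (f n))) n k
     = (of_int (composita (series_from_1 f) n k) :: 'a::comm_ring_1)"
proof -
  have "(\<Prod>l\<leftarrow>ls. fps_nth (series_from_1 (\<lambda>n. of_int (f n))) l)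
      = (of_int (\<Prod>l\<leftarrow>ls. fps_nth (series_from_1 f) l) :: 'a)" for ls
    by (induction ls) (auto simp: series_from_1_def)
  then show ?thesis
    by (simp add: composita_def)
qed

text \<open>
  The factor \<open>n\<close> is what differentiation puts in front of the coefficient of \<open>x\<^sup>n\<close>, and the
  factor \<open>k\<close> is what the power rule puts in front of \<open>F\<^sup>k\<^sup>-\<^sup>1 F'\<close>.
\<close>

lemma dvd_mult_nth_power:
  fixes F :: "int fps"
  shows "int k dvd int n * fps_nth (F ^ k) n"
proof (cases n)
  case 0
  then show ?thesis by simp
next
  case (Suc m)
  have "int n * fps_nth (F ^ k) n = fps_nth (fps_deriv (F ^ k)) m"
    by (simp add: Suc)
  also have "\<dots> = int k * fps_nth (fps_deriv F * F ^ (k - 1)) m"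
    by (simp add: fps_deriv_power mult.assoc fps_of_nat[symmetric] del: fps_of_nat)
  finally show ?thesis
    by simp
qed

lemma composita_divide_in_Ints:
  assumes "coprime n k"
  shows "composita (series_from_1 (\<lambda>n. of_int (f n))) n k / of_nat k \<in> (\<int> :: rat set)"
proof -
  let ?F = "series_from_1 f"
  have "int k dvd int n * composita ?F n k"
    using dvd_mult_nth_power[of k n ?F]
    by (simp add: composita_eq_nth_power series_from_1_def)
  moreover have "coprime (int k) (int n)"
    using assms by (simp add: coprime_commute)
  ultimately have "int k dvd composita ?F n k"
    by (simp add: coprime_dvd_mult_right_iff)
  then obtain c where "composita ?F n k = int k * c" ..
  then show ?thesis
    by (cases "k = 0") (simp_all add: composita_of_int)
qed

theorem corollary3p1:
  shows
    "(\<forall>(f :: nat \<Rightarrow> int) (a :: nat \<Rightarrow> int) (F :: rat fps) (R :: rat fps) (G :: rat fps).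
        F = series_from_1 (\<lambda>n. of_int (f n)) \<longrightarrow>
        R = series_from_1 (\<lambda>n. of_int (a n) / of_nat n) \<longrightarrow>
        G = fps_compose R F \<longrightarrow>
          fps_nth G 0 = 0 \<and>
          (\<forall>n\<ge>1. fps_nth G n = (\<Sum>k = 1..n. composita F n k * of_int (a k) / of_nat k)) \<and>
          (\<forall>n\<ge>1. (\<Sum>k = 1..n - 1. composita F n k * of_int (a k) / of_nat k)
                 = (of_nat n * fps_nth G n - of_int (a n) * of_int (f 1) ^ n) / of_nat n) \<and>
          (\<forall>n. prime n \<longrightarrow>
             (\<Sum>k = 1..n - 1. composita F n k * of_int (a k) / of_nat k) \<in> \<int>))
     \<and>
     (\<exists>(f :: nat \<Rightarrow> int) (a :: nat \<Rightarrow> int) (F :: rat fps) (n :: nat).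
        F = series_from_1 (\<lambda>n. of_int (f n)) \<and>
        n > 1 \<and> \<not> prime n \<and>
        (\<Sum>k = 1..n - 1. composita F n k * of_int (a k) / of_nat k) \<in> \<int>)"
proof (intro conjI allI impI)
  fix f a :: "nat \<Rightarrow> int" and F R G :: "rat fps"
  assume F: "F = series_from_1 (\<lambda>n. of_int (f n))"
    and R: "R = series_from_1 (\<lambda>n. of_int (a n) / of_nat n)"
    and G: "G = fps_compose R F"
  have F0: "fps_nth F 0 = 0" and F1: "fps_nth F 1 = of_int (f 1)"
    by (simp_all add: F series_from_1_def)
  show "fps_nth G 0 = 0"
    by (simp add: G R series_from_1_def)
  have nth_G: "fps_nth G n = (\<Sum>k = 1..n. composita F n k * of_int (a k) / of_nat k)" for n
  proof -
    have "fps_nth G n = (\<Sum>k = 0..n. fps_nth R k * fps_nth (F ^ k) n)"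
      by (simp add: G fps_compose_nth)
    also have "\<dots> = (\<Sum>k = 1..n. fps_nth R k * fps_nth (F ^ k) n)"
      by (simp add: sum.atLeast_Suc_atMost R series_from_1_def)
    also have "\<dots> = (\<Sum>k = 1..n. composita F n k * of_int (a k) / of_nat k)"
      by (rule sum.cong) (auto simp: R series_from_1_def composita_eq_nth_power[OF F0])
    finally show ?thesis .
  qed
  show "fps_nth G n = (\<Sum>k = 1..n. composita F n k * of_int (a k) / of_nat k)" for n
    by (rule nth_G)
  show "(\<Sum>k = 1..n - 1. composita F n k * of_int (a k) / of_nat k)
      = (of_nat n * fps_nth G n - of_int (a n) * of_int (f 1) ^ n) / of_nat n"
    if "n \<ge> 1" for n
  proof -
    have diag: "composita F n n = of_int (f 1) ^ n"
      unfolding composita_eq_nth_power[OF F0] startsby_zero_power_nth_same[OF F0] F1 ..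
    obtain m where m: "n = Suc m"
      using \<open>n \<ge> 1\<close> by (cases n) auto
    have "fps_nth G n = (\<Sum>k = 1..n - 1. composita F n k * of_int (a k) / of_nat k)
        + of_int (f 1) ^ n * of_int (a n) / of_nat n"
      unfolding nth_G diag[symmetric] by (simp add: m)
    then show ?thesis
      using \<open>n \<ge> 1\<close> by (simp add: field_simps)
  qed
  show "(\<Sum>k = 1..n - 1. composita F n k * of_int (a k) / of_nat k) \<in> \<int>"
    if "prime n" for n
  proof (rule Ints_sum)
    fix k
    assume k: "k \<in> {1..n - 1}"
    then have "\<not> n dvd k"
      by (auto dest: dvd_imp_le)
    then have "coprime n k"
      using \<open>prime n\<close> by (simp add: prime_imp_coprime)
    then have "of_int (a k) * (composita F n k / of_nat k) \<in> \<int>"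
      unfolding F by (intro Ints_mult Ints_of_int composita_divide_in_Ints)
    then show "composita F n k * of_int (a k) / of_nat k \<in> \<int>"
      by (simp add: mult.commute)
  qed
next
  let ?F = "series_from_1 (\<lambda>n. of_int 1) :: rat fps"
  \<comment> \<open>With \<open>a\<^sub>k = k\<close> the denominators cancel, for any integer series and any composite number.\<close>
  have "(\<Sum>k = 1..4 - 1. composita ?F 4 k * of_int (int k) / of_nat k) \<in> \<int>"
  proof (rule Ints_sum)
    fix k :: nat
    assume "k \<in> {1..4 - 1}"
    then have "composita ?F 4 k * of_int (int k) / of_nat k = composita ?F 4 k"
      by simp
    then show "composita ?F 4 k * of_int (int k) / of_nat k \<in> \<int>"
      using composita_of_int[of "\<lambda>_. 1" 4 k, where ?'a = rat] by simp
  qed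
  moreover have "\<not> prime (4 :: nat)"
    using prime_product[of 2 "2 :: nat"] by auto
  ultimately show "\<exists>(f :: nat \<Rightarrow> int) (a :: nat \<Rightarrow> int) (F :: rat fps) (n :: nat).
      F = series_from_1 (\<lambda>n. of_int (f n)) \<and> n > 1 \<and> \<not> prime n \<and>
      (\<Sum>k = 1..n - 1. composita F n k * of_int (a k) / of_nat k) \<in> \<int>"
    by (intro exI[of _ "\<lambda>_. 1"] exI[of _ int] exI[of _ ?F] exI[of _ "4 :: nat"]) simp
qed

end
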